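(* Let $\alpha_1, \alpha_2 \in [0,1]$ with $0<\alpha_1+\alpha_2<2$, let $\Omega$ be a convex subset of a Banach space $\mathbb{X}$, and let $(a_n)_{n \in \mathbb{N}}$, $(b_n)_{n \in \mathbb{N}}$ be two sequences in $[0,1]$ such that $$1-a_k - \alpha_1 a_k>0 \quad\text{and}\quad 1-b_k - \alpha_2 b_k>0 \quad \text{for all } k \in \mathbb{N}.$$ Then the optimal lower error bound (OLEB) sequence $(\mathcal{L}_n^{\mathrm{IM}})_{n\in\mathbb{N}}$ of the modified Ishikawa iterative process $$x_0\in\Omega,\qquad y_n=(1-a_n)x_n+a_nT_1(x_n),\qquad x_{n+1}=(1-b_n)y_n+b_nT_2(y_n),\quad n\in\mathbb{N},$$ is given by $$\mathcal{L}_n^{\mathrm{IM}} = \prod_{k=0}^n (1-a_k - \alpha_1 a_k)(1-b_k - \alpha_2 b_k), \quad n \in \mathbb{N}.$$ Moreover, $$\lim_{n\to \infty}\mathcal{L}^{\mathrm{IM}}_n=0\iff \sum_{k=0}^{\infty}(a_k+b_k)=+\infty.$$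
   Context: Banach spaces are real; $\Omega$ is non-empty; $\mathbb{N}=\{0,1,2,\dots\}$. For $\alpha\in[0,1]$, $\mathbf{Ne}_{\alpha}(\Omega)$ is the set of maps $T:\Omega\to\Omega$ with $\|T(x)-T(y)\|\le\alpha\|x-y\|$ for all $x,y\in\Omega$. $\mathcal{F}(T_1,T_2)$ is the set of common fixed points, i.e. of $x^*\in\Omega$ with $T_1(x^* )=T_2(x^* )=x^*$. The process is considered for $T_1\in\mathbf{Ne}_{\alpha_1}(\Omega)$, $T_2\in\mathbf{Ne}_{\alpha_2}(\Omega)$ having a common fixed point. A non-negative sequence $(\mathcal{L}_n)_{n\in\mathbb{N}}$ is a lower error bound of the process if $\|x_{n+1}-x^*\|\ge\mathcal{L}_n\|x_0-x^*\|$ for all $n\in\mathbb{N}$, for any pair $T_1\in\mathbf{Ne}_{\alpha_1}(\Omega)$, $T_2\in\mathbf{Ne}_{\alpha_2}(\Omega)$ with $x^*\in\mathcal{F}(T_1,T_2)$ and any initial point $x_0\in\Omega$. It is optimal (an OLEB) if moreover there exist $T_1\in\mathbf{Ne}_{\alpha_1}(\Omega)$, $T_2\in\mathbf{Ne}_{\alpha_2}(\Omega)$ and $x^*\in\mathcal{F}(T_1,T_2)$ such that $\|x_{n+1}-x^*\|=\mathcal{L}_n\|x_0-x^*\|$ for every $n\in\mathbb{N}$ and every $x_0\in\Omega$.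
   Formalization: Optimality is claimed only if some c in Ω has c − α_i(x − c) in Ω for all x in Ω and i = 1, 2; for general convex Ω it can fail (e.g. Ω = [0,∞), α_i = 1/2, a_n = b_n = 1/4). The lower bound and the limit equivalence are stated for every non-empty convex Ω. *)

theory Defs
  imports "HOL-Analysis.Analysis"
begin

definition Ne :: "real \<Rightarrow> 'a::banach set \<Rightarrow> ('a \<Rightarrow> 'a) set" where
  "Ne \<alpha> \<Omega> = {T. T \<in> \<Omega> \<rightarrow> \<Omega> \<and> \<alpha>-lipschitz_on \<Omega> T}"

definition common_fixpoints :: "'a::banach set \<Rightarrow> ('a \<Rightarrow> 'a) \<Rightarrow> ('a \<Rightarrow> 'a) \<Rightarrow> 'a set" where
  "common_fixpoints \<Omega> T1 T2 = {x \<in> \<Omega>. T1 x = x \<and> T2 x = x}"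

primrec ishikawa ::
  "(nat \<Rightarrow> real) \<Rightarrow> (nat \<Rightarrow> real) \<Rightarrow> ('a::banach \<Rightarrow> 'a) \<Rightarrow> ('a \<Rightarrow> 'a) \<Rightarrow> 'a \<Rightarrow> nat \<Rightarrow> 'a" where
  "ishikawa a b T1 T2 x0 0 = x0"
| "ishikawa a b T1 T2 x0 (Suc n) =
    (let x = ishikawa a b T1 T2 x0 n;
         y = (1 - a n) *\<^sub>R x + a n *\<^sub>R T1 x
     in (1 - b n) *\<^sub>R y + b n *\<^sub>R T2 y)"

definition lower_error_bound ::
  "'a::banach set \<Rightarrow> real \<Rightarrow> real \<Rightarrow> (nat \<Rightarrow> real) \<Rightarrow> (nat \<Rightarrow> real) \<Rightarrow> (nat \<Rightarrow> real) \<Rightarrow> bool" where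
  "lower_error_bound \<Omega> \<alpha>1 \<alpha>2 a b L \<longleftrightarrow>
    (\<forall>n. 0 \<le> L n) \<and>
    (\<forall>T1 \<in> Ne \<alpha>1 \<Omega>. \<forall>T2 \<in> Ne \<alpha>2 \<Omega>. \<forall>p \<in> common_fixpoints \<Omega> T1 T2. \<forall>x0 \<in> \<Omega>. \<forall>n.
      norm (ishikawa a b T1 T2 x0 (Suc n) - p) \<ge> L n * norm (x0 - p))"

definition OLEB ::
  "'a::banach set \<Rightarrow> real \<Rightarrow> real \<Rightarrow> (nat \<Rightarrow> real) \<Rightarrow> (nat \<Rightarrow> real) \<Rightarrow> (nat \<Rightarrow> real) \<Rightarrow> bool" where
  "OLEB \<Omega> \<alpha>1 \<alpha>2 a b L \<longleftrightarrow>
    lower_error_bound \<Omega> \<alpha>1 \<alpha>2 a b L \<and>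
    (\<exists>T1 \<in> Ne \<alpha>1 \<Omega>. \<exists>T2 \<in> Ne \<alpha>2 \<Omega>. \<exists>p \<in> common_fixpoints \<Omega> T1 T2. \<forall>n. \<forall>x0 \<in> \<Omega>.
      norm (ishikawa a b T1 T2 x0 (Suc n) - p) = L n * norm (x0 - p))"

definition L_IM ::
  "real \<Rightarrow> real \<Rightarrow> (nat \<Rightarrow> real) \<Rightarrow> (nat \<Rightarrow> real) \<Rightarrow> nat \<Rightarrow> real" where
  "L_IM \<alpha>1 \<alpha>2 a b n = (\<Prod>k=0..n. (1 - a k - \<alpha>1 * a k) * (1 - b k - \<alpha>2 * b k))"

text \<open>
  Convexity of \<open>\<Omega>\<close> alone does not guarantee that the bound is attained on \<open>\<Omega>\<close>: on the half-line
  attainment fails whenever \<open>\<alpha>\<^sub>1 > 0\<close> and \<open>a\<^sub>0 > 0\<close> (lemma \<open>not_OLEB_half_line\<close>). The extremal maps are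
  \<open>x \<mapsto> c - \<alpha>\<^sub>i (x - c)\<close>, and the following condition says that they send \<open>\<Omega>\<close> into itself for a
  suitable \<open>c\<close>. It holds for instance when \<open>\<Omega>\<close> is the whole space, or is convex and symmetric
  about one of its points.
\<close>

definition has_reflection_centre :: "'a::banach set \<Rightarrow> real \<Rightarrow> real \<Rightarrow> bool" where
  "has_reflection_centre \<Omega> \<alpha>1 \<alpha>2 \<longleftrightarrow>
    (\<exists>c\<in>\<Omega>. \<forall>x\<in>\<Omega>. c - \<alpha>1 *\<^sub>R (x - c) \<in> \<Omega> \<and> c - \<alpha>2 *\<^sub>R (x - c) \<in> \<Omega>)"

lemma not_OLEB_half_line:
  fixes a b :: "nat \<Rightarrow> real"
  assumes \<alpha>1: "0 < \<alpha>1" and \<alpha>2: "0 \<le> \<alpha>2" and a0: "0 < a 0" and b0: "0 \<le> b 0"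
    and pa: "0 < 1 - a 0 - \<alpha>1 * a 0" and pb: "0 < 1 - b 0 - \<alpha>2 * b 0"
  shows "\<not> OLEB {0::real..} \<alpha>1 \<alpha>2 a b (L_IM \<alpha>1 \<alpha>2 a b)"
proof
  assume "OLEB {0::real..} \<alpha>1 \<alpha>2 a b (L_IM \<alpha>1 \<alpha>2 a b)"
  then obtain T1 T2 p where T1: "T1 \<in> Ne \<alpha>1 {0::real..}" and T2: "T2 \<in> Ne \<alpha>2 {0..}"
    and p: "p \<in> common_fixpoints {0..} T1 T2"
    and eq: "\<forall>n. \<forall>x0\<in>{0..}.
      norm (ishikawa a b T1 T2 x0 (Suc n) - p) = L_IM \<alpha>1 \<alpha>2 a b n * norm (x0 - p)"
    unfolding OLEB_def by blast
  define q where "q = 1 - a 0 - \<alpha>1 * a 0"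
  define r where "r = 1 - b 0 - \<alpha>2 * b 0"
  have q0: "0 < q" and r0: "0 < r" using pa pb by (simp_all add: q_def r_def)
  have p0: "p \<ge> 0" "T2 p = p" using p by (auto simp: common_fixpoints_def)
  have "0 < \<alpha>1 * a 0" using \<alpha>1 a0 by simp
  then have a1: "0 < 1 - a 0" using pa by linarith
  define x where "x = p + (p + 1) / (\<alpha>1 * a 0)"
  define y where "y = (1 - a 0) * x + a 0 * T1 x"
  have xp: "x > p" unfolding x_def using p0 \<open>0 < \<alpha>1 * a 0\<close> by simp
  have T1x: "T1 x \<ge> 0" using T1 xp p0 by (auto simp: Ne_def Pi_iff)
  have y1: "y \<ge> (1 - a 0) * x" unfolding y_def using T1x a0 by simp
  have "(1 - a 0) * x - p - q * (x - p) = \<alpha>1 * a 0 * (x - p) - a 0 * p"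
    by (simp add: q_def algebra_simps)
  also have "\<alpha>1 * a 0 * (x - p) = p + 1"
    unfolding x_def using \<alpha>1 a0 by simp
  also have "p + 1 - a 0 * p > 0"
    using p0 a1 mult_nonneg_nonneg[of "1 - a 0" p] by (simp add: algebra_simps)
  finally have yq: "y - p > q * (x - p)" using y1 by linarith
  have y0: "y \<ge> 0" using yq mult_pos_pos[OF q0, of "x - p"] xp p0 by linarith
  have "\<bar>T2 y - p\<bar> \<le> \<alpha>2 * \<bar>y - p\<bar>"
    using T2 y0 p0 lipschitz_onD[of \<alpha>2 "{0..}" T2 y p] by (auto simp: Ne_def dist_real_def)
  then have "b 0 * (T2 y - p) \<ge> - (b 0 * (\<alpha>2 * \<bar>y - p\<bar>))"
    using mult_left_mono[of "- (T2 y - p)" "\<alpha>2 * \<bar>y - p\<bar>" "b 0"] b0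
    by (simp add: algebra_simps abs_le_iff)
  moreover have ypos: "y - p > 0" using yq mult_pos_pos[OF q0, of "x - p"] xp by linarith
  ultimately have "(1 - b 0) * (y - p) + b 0 * (T2 y - p) \<ge> r * (y - p)"
    by (simp add: r_def algebra_simps)
  moreover have "r * (y - p) > r * (q * (x - p))" using yq r0 by simp
  moreover have "\<bar>(1 - b 0) * (y - p) + b 0 * (T2 y - p)\<bar> = q * r * (x - p)"
    using eq[rule_format, of x 0] xp p0 by (simp add: L_IM_def q_def r_def Let_def y_def algebra_simps)
  ultimately show False by (simp add: algebra_simps)
qed

end

theory Submission
  imports Defs
begin

text \<open>
  One averaging step \<open>x \<mapsto> (1 - t) x + t T x\<close> shrinks the distance to a fixed point of \<open>T\<close> by a
  factor of at least \<open>1 - t - \<alpha> t\<close>, with equality when \<open>T\<close> is the scaled reflection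
  \<open>x \<mapsto> c - \<alpha> (x - c)\<close>. Taking both maps to be such reflections about the same centre therefore
  attains the product bound. A product of factors \<open>1 - t\<^sub>k \<in> (0, 1]\<close> vanishes in the limit
  exactly when \<open>\<Sum> t\<^sub>k\<close> diverges, and the defect \<open>t\<^sub>k\<close> of the \<open>k\<close>-th factor here is comparable
  to \<open>a\<^sub>k + b\<^sub>k\<close>.
\<close>

section \<open>Series and infinite products\<close>

lemma filterlim_sum_at_top_iff_not_summable:
  fixes f :: "nat \<Rightarrow> real"
  assumes nonneg: "\<And>k. 0 \<le> f k"
  shows "filterlim (\<lambda>n. \<Sum>k\<le>n. f k) at_top sequentially \<longleftrightarrow> \<not> summable f"
proof
  assume lim: "filterlim (\<lambda>n. \<Sum>k\<le>n. f k) at_top sequentially"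
  show "\<not> summable f"
  proof
    assume sf: "summable f"
    from lim obtain n where "suminf f + 1 \<le> (\<Sum>k\<le>n. f k)"
      unfolding filterlim_at_top eventually_sequentially by blast
    then show False
      using sum_le_suminf[OF sf, of "{..n}"] nonneg by simp
  qed
next
  assume ns: "\<not> summable f"
  show "filterlim (\<lambda>n. \<Sum>k\<le>n. f k) at_top sequentially"
    unfolding filterlim_at_top eventually_sequentially
  proof
    fix Z
    \<comment> \<open>Bounded partial sums of non-negative terms would force summability, so some
      partial sum exceeds \<open>Z\<close>; by monotonicity all later ones do too.\<close>
    obtain N where N: "Z < (\<Sum>k\<le>N. f k)"
      using ns bounded_imp_summable[of f Z] nonneg by (meson not_le)
    have "Z \<le> (\<Sum>k\<le>n. f k)" if "N \<le> n" for n
      using N sum_mono2[of "{..n}" "{..N}" f] that nonneg by fastforce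
    then show "\<exists>N. \<forall>n\<ge>N. Z \<le> (\<Sum>k\<le>n. f k)" by blast
  qed
qed

text \<open>If \<open>t\<close> is summable, the product converges absolutely, and since no factor
  vanishes its limit is non-zero. If not, \<open>1 - s \<le> exp (- s)\<close> bounds the product by
  the exponential of minus a divergent sum.\<close>

lemma prod_one_minus_tendsto_0_iff:
  fixes t :: "nat \<Rightarrow> real"
  assumes nonneg: "\<And>k. 0 \<le> t k" and less: "\<And>k. t k < 1"
  shows "(\<lambda>n. \<Prod>k\<le>n. 1 - t k) \<longlonglongrightarrow> 0 \<longleftrightarrow> \<not> summable t"
proof
  assume lim: "(\<lambda>n. \<Prod>k\<le>n. 1 - t k) \<longlonglongrightarrow> 0"
  show "\<not> summable t"
  proof
    assume "summable t"
    then have "convergent_prod (\<lambda>k. 1 - t k)"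
      using nonneg
      by (intro abs_convergent_prod_imp_convergent_prod summable_imp_abs_convergent_prod) simp
    then show False
      using lim less by (simp add: less_imp_neq)
  qed
next
  assume "\<not> summable t"
  then have "filterlim (\<lambda>n. - (\<Sum>k\<le>n. t k)) at_bot sequentially"
    using nonneg by (simp add: filterlim_uminus_at_bot filterlim_sum_at_top_iff_not_summable)
  then have lim: "(\<lambda>n. exp (- (\<Sum>k\<le>n. t k))) \<longlonglongrightarrow> 0"
    using exp_at_bot filterlim_compose by blast
  have le: "(\<Prod>k\<le>n. 1 - t k) \<le> exp (- (\<Sum>k\<le>n. t k))" for n
  proof -
    have "(\<Prod>k\<le>n. 1 - t k) \<le> (\<Prod>k\<le>n. exp (- t k))"
      using less exp_ge_add_one_self[of "- t _"] by (intro prod_mono) (simp add: less_imp_le)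
    then show ?thesis
      by (simp add: exp_sum flip: sum_negf)
  qed
  have ge: "0 \<le> (\<Prod>k\<le>n. 1 - t k)" for n
    using less by (intro prod_nonneg) (simp add: less_imp_le)
  show "(\<lambda>n. \<Prod>k\<le>n. 1 - t k) \<longlonglongrightarrow> 0"
    by (rule tendsto_sandwich[OF _ _ tendsto_const lim]) (simp_all add: le ge)
qed

section \<open>Lower bound along the iteration\<close>

lemma L_IM_Suc:
  "L_IM \<alpha>1 \<alpha>2 a b (Suc n) = L_IM \<alpha>1 \<alpha>2 a b n *
    ((1 - a (Suc n) - \<alpha>1 * a (Suc n)) * (1 - b (Suc n) - \<alpha>2 * b (Suc n)))"
  by (simp add: L_IM_def)

lemma averaging_step_in:
  assumes "convex \<Omega>" "T \<in> Ne \<alpha> \<Omega>" "t \<in> {0..1}" "x \<in> \<Omega>"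
  shows "(1 - t) *\<^sub>R x + t *\<^sub>R T x \<in> \<Omega>"
  using assms by (intro convexD_alt) (auto simp: Ne_def)

text \<open>Reverse triangle inequality: after subtracting \<open>p = T p\<close>, the new point is
  \<open>(1 - t)(x - p)\<close> plus \<open>t (T x - p)\<close>, and the second summand has norm at
  most \<open>t \<alpha>\<close> times that of \<open>x - p\<close>.\<close>

lemma averaging_step_lower_bound:
  assumes T: "T \<in> Ne \<alpha> \<Omega>" and t: "t \<in> {0..1}"
    and x: "x \<in> \<Omega>" and p: "p \<in> \<Omega>" "T p = p"
  shows "(1 - t - \<alpha> * t) * norm (x - p) \<le> norm ((1 - t) *\<^sub>R x + t *\<^sub>R T x - p)"
proof -
  have "norm (T x - p) \<le> \<alpha> * norm (x - p)"
    using T x p lipschitz_onD[of \<alpha> \<Omega> T x p] by (simp add: Ne_def dist_norm)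
  then have "norm (t *\<^sub>R (T x - p)) \<le> t * (\<alpha> * norm (x - p))"
    using t by (simp add: mult_left_mono)
  moreover have "norm ((1 - t) *\<^sub>R (x - p)) = (1 - t) * norm (x - p)"
    using t by simp
  moreover have "norm ((1 - t) *\<^sub>R (x - p)) - norm (t *\<^sub>R (T x - p))
      \<le> norm ((1 - t) *\<^sub>R (x - p) + t *\<^sub>R (T x - p))"
    by (rule norm_diff_ineq)
  moreover have "(1 - t) *\<^sub>R (x - p) + t *\<^sub>R (T x - p) = (1 - t) *\<^sub>R x + t *\<^sub>R T x - p"
    by (simp add: algebra_simps)
  ultimately show ?thesis
    by (simp add: algebra_simps)
qed

lemma ishikawa_in:
  assumes "convex \<Omega>" "T1 \<in> Ne \<alpha>1 \<Omega>" "T2 \<in> Ne \<alpha>2 \<Omega>" "x0 \<in> \<Omega>"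
    and "\<And>k. a k \<in> {0..1}" "\<And>k. b k \<in> {0..1}"
  shows "ishikawa a b T1 T2 x0 n \<in> \<Omega>"
proof (induction n)
  case (Suc n)
  show ?case
    unfolding ishikawa.simps Let_def
    by (intro averaging_step_in[OF assms(1,3)] averaging_step_in[OF assms(1,2)] assms(5,6) Suc)
qed (simp add: assms)

text \<open>Two averaging bounds are chained through the intermediate point \<open>y\<close>, which
  convexity keeps in \<open>\<Omega>\<close>. The sign condition \<open>pos\<close> allows the bound
  for the first half step to be multiplied by the factor of the second.\<close>

lemma ishikawa_step_lower_bound:
  assumes convex: "convex \<Omega>" and T: "T1 \<in> Ne \<alpha>1 \<Omega>" "T2 \<in> Ne \<alpha>2 \<Omega>"
    and p: "p \<in> common_fixpoints \<Omega> T1 T2" and x0: "x0 \<in> \<Omega>"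
    and ab: "\<And>k. a k \<in> {0..1}" "\<And>k. b k \<in> {0..1}"
    and pos: "1 - b n - \<alpha>2 * b n \<ge> 0"
  shows "(1 - a n - \<alpha>1 * a n) * (1 - b n - \<alpha>2 * b n) * norm (ishikawa a b T1 T2 x0 n - p)
    \<le> norm (ishikawa a b T1 T2 x0 (Suc n) - p)"
proof -
  define x where "x = ishikawa a b T1 T2 x0 n"
  define y where "y = (1 - a n) *\<^sub>R x + a n *\<^sub>R T1 x"
  have x: "x \<in> \<Omega>"
    unfolding x_def by (rule ishikawa_in[OF convex T x0 ab])
  have y: "y \<in> \<Omega>"
    unfolding y_def by (rule averaging_step_in[OF convex T(1) ab(1) x])
  have p': "p \<in> \<Omega>" "T1 p = p" "T2 p = p"
    using p by (auto simp: common_fixpoints_def)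
  have "(1 - b n - \<alpha>2 * b n) * ((1 - a n - \<alpha>1 * a n) * norm (x - p))
      \<le> (1 - b n - \<alpha>2 * b n) * norm (y - p)"
    unfolding y_def
    by (intro mult_left_mono averaging_step_lower_bound[OF T(1) ab(1) x] p' pos)
  also have "\<dots> \<le> norm ((1 - b n) *\<^sub>R y + b n *\<^sub>R T2 y - p)"
    by (rule averaging_step_lower_bound[OF T(2) ab(2) y p'(1,3)])
  finally show ?thesis
    by (simp add: x_def y_def Let_def mult_ac)
qed

lemma lower_error_bound_L_IM:
  fixes \<Omega> :: "'a::banach set"
  assumes convex: "convex \<Omega>"
    and ab: "\<And>k. a k \<in> {0..1}" "\<And>k. b k \<in> {0..1}"
    and pos: "\<And>k. 0 < 1 - a k - \<alpha>1 * a k" "\<And>k. 0 < 1 - b k - \<alpha>2 * b k"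
  shows "lower_error_bound \<Omega> \<alpha>1 \<alpha>2 a b (L_IM \<alpha>1 \<alpha>2 a b)"
  unfolding lower_error_bound_def
proof (intro conjI ballI allI)
  show "0 \<le> L_IM \<alpha>1 \<alpha>2 a b n" for n
    unfolding L_IM_def using pos by (intro prod_nonneg) (simp add: less_imp_le)
next
  fix T1 T2 :: "'a \<Rightarrow> 'a" and p x0 n
  assume T: "T1 \<in> Ne \<alpha>1 \<Omega>" "T2 \<in> Ne \<alpha>2 \<Omega>"
    and p: "p \<in> common_fixpoints \<Omega> T1 T2" and x0: "x0 \<in> \<Omega>"
  have step: "(1 - a n - \<alpha>1 * a n) * (1 - b n - \<alpha>2 * b n) * norm (ishikawa a b T1 T2 x0 n - p)
      \<le> norm (ishikawa a b T1 T2 x0 (Suc n) - p)" for n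
    by (rule ishikawa_step_lower_bound[OF convex T p x0 ab less_imp_le[OF pos(2)]])
  show "L_IM \<alpha>1 \<alpha>2 a b n * norm (x0 - p) \<le> norm (ishikawa a b T1 T2 x0 (Suc n) - p)"
  proof (induction n)
    case 0
    show ?case
      using step[of 0] by (simp add: L_IM_def)
  next
    case (Suc n)
    let ?c = "(1 - a (Suc n) - \<alpha>1 * a (Suc n)) * (1 - b (Suc n) - \<alpha>2 * b (Suc n))"
    have "L_IM \<alpha>1 \<alpha>2 a b (Suc n) * norm (x0 - p) = ?c * (L_IM \<alpha>1 \<alpha>2 a b n * norm (x0 - p))"
      by (simp only: L_IM_Suc mult_ac)
    also have "\<dots> \<le> ?c * norm (ishikawa a b T1 T2 x0 (Suc n) - p)"
      using Suc pos by (intro mult_left_mono) (simp_all add: less_imp_le)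
    also have "\<dots> \<le> norm (ishikawa a b T1 T2 x0 (Suc (Suc n)) - p)"
      by (rule step)
    finally show ?case .
  qed
qed

section \<open>Attainment by scaled reflections\<close>

lemma reflection_in_Ne:
  assumes "0 \<le> \<alpha>" and "\<And>x. x \<in> \<Omega> \<Longrightarrow> c - \<alpha> *\<^sub>R (x - c) \<in> \<Omega>"
  shows "(\<lambda>x. c - \<alpha> *\<^sub>R (x - c)) \<in> Ne \<alpha> \<Omega>"
proof -
  have "norm (c - \<alpha> *\<^sub>R (x - c) - (c - \<alpha> *\<^sub>R (y - c))) = \<alpha> * norm (x - y)" for x y
  proof -
    have "c - \<alpha> *\<^sub>R (x - c) - (c - \<alpha> *\<^sub>R (y - c)) = - (\<alpha> *\<^sub>R (x - y))"
      by (simp add: algebra_simps)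
    then show ?thesis
      using assms(1) by (simp only: norm_minus_cancel norm_scaleR abs_of_nonneg)
  qed
  then show ?thesis
    using assms by (auto simp: Ne_def dist_norm intro!: lipschitz_onI)
qed

text \<open>Averaging with a scaled reflection about \<open>c\<close> is a homothety with the same
  centre, so the ratios of successive half steps multiply. This is an identity of vectors; norms
  enter only when attainment is proved.\<close>

lemma ishikawa_reflections:
  "ishikawa a b (\<lambda>x. c - \<alpha>1 *\<^sub>R (x - c)) (\<lambda>x. c - \<alpha>2 *\<^sub>R (x - c)) x0 (Suc n) - c
    = L_IM \<alpha>1 \<alpha>2 a b n *\<^sub>R (x0 - c)"
  for c x0 :: "'a::banach"
proof -
  have avg: "(1 - t) *\<^sub>R x + t *\<^sub>R (c - \<alpha> *\<^sub>R (x - c)) = c + (1 - t - \<alpha> * t) *\<^sub>R (x - c)"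
    for t \<alpha> and x :: 'a
    by (simp add: algebra_simps)
  define z where "z = ishikawa a b (\<lambda>x. c - \<alpha>1 *\<^sub>R (x - c)) (\<lambda>x. c - \<alpha>2 *\<^sub>R (x - c)) x0"
  have step: "z (Suc n) - c
      = ((1 - a n - \<alpha>1 * a n) * (1 - b n - \<alpha>2 * b n)) *\<^sub>R (z n - c)" for n
    unfolding z_def ishikawa.simps Let_def avg by (simp add: mult.commute)
  have "z (Suc n) - c = L_IM \<alpha>1 \<alpha>2 a b n *\<^sub>R (x0 - c)"
  proof (induction n)
    case 0
    show ?case
      unfolding step by (simp add: L_IM_def z_def)
  next
    case (Suc n)
    show ?case
      unfolding step[of "Suc n"] Suc L_IM_Suc scaleR_scaleR by (simp only: mult.commute)
  qed
  then show ?thesis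
    by (simp only: z_def)
qed

text \<open>The reflections about the centre \<open>c\<close> are the witnesses. Non-negativity of
  the bound, contained in \<open>leb\<close>, removes the absolute value when norms are taken in
  \<open>ishikawa_reflections\<close>.\<close>

lemma OLEB_L_IM:
  assumes leb: "lower_error_bound \<Omega> \<alpha>1 \<alpha>2 a b (L_IM \<alpha>1 \<alpha>2 a b)"
    and \<alpha>: "0 \<le> \<alpha>1" "0 \<le> \<alpha>2" and "has_reflection_centre \<Omega> \<alpha>1 \<alpha>2"
  shows "OLEB \<Omega> \<alpha>1 \<alpha>2 a b (L_IM \<alpha>1 \<alpha>2 a b)"
proof -
  obtain c where c: "c \<in> \<Omega>" "\<And>x. x \<in> \<Omega> \<Longrightarrow> c - \<alpha>1 *\<^sub>R (x - c) \<in> \<Omega>"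
      "\<And>x. x \<in> \<Omega> \<Longrightarrow> c - \<alpha>2 *\<^sub>R (x - c) \<in> \<Omega>"
    using assms(4) by (auto simp: has_reflection_centre_def)
  have nonneg: "0 \<le> L_IM \<alpha>1 \<alpha>2 a b n" for n
    using leb by (simp add: lower_error_bound_def)
  show ?thesis
    unfolding OLEB_def
  proof (intro conjI leb bexI allI ballI)
    show "(\<lambda>x. c - \<alpha>1 *\<^sub>R (x - c)) \<in> Ne \<alpha>1 \<Omega>" "(\<lambda>x. c - \<alpha>2 *\<^sub>R (x - c)) \<in> Ne \<alpha>2 \<Omega>"
      by (intro reflection_in_Ne \<alpha> c; assumption)+
    show "c \<in> common_fixpoints \<Omega> (\<lambda>x. c - \<alpha>1 *\<^sub>R (x - c)) (\<lambda>x. c - \<alpha>2 *\<^sub>R (x - c))"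
      using c(1) by (simp add: common_fixpoints_def)
  qed (simp only: ishikawa_reflections norm_scaleR abs_of_nonneg[OF nonneg])
qed

section \<open>Uniqueness of the optimal bound\<close>

lemma OLEB_dominates_lower_error_bound:
  assumes "OLEB \<Omega> \<alpha>1 \<alpha>2 a b L" and "lower_error_bound \<Omega> \<alpha>1 \<alpha>2 a b L'"
    and "x \<in> \<Omega>" "y \<in> \<Omega>" "x \<noteq> y"
  shows "L' n \<le> L n"
proof -
  obtain T1 T2 p where T: "T1 \<in> Ne \<alpha>1 \<Omega>" "T2 \<in> Ne \<alpha>2 \<Omega>" "p \<in> common_fixpoints \<Omega> T1 T2"
    and eq: "\<And>n x0. x0 \<in> \<Omega> \<Longrightarrow>
      norm (ishikawa a b T1 T2 x0 (Suc n) - p) = L n * norm (x0 - p)"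
    using assms(1) unfolding OLEB_def by blast
  \<comment> \<open>Of two distinct points at least one differs from \<open>p\<close>. Starting the
    extremal process of \<open>L\<close> there gives a non-zero initial error, which can be
    cancelled.\<close>
  obtain z where z: "z \<in> \<Omega>" "z \<noteq> p"
    using assms(3-5) by metis
  have "L' n * norm (z - p) \<le> L n * norm (z - p)"
    using assms(2) T z(1) unfolding eq[OF z(1), symmetric] lower_error_bound_def by blast
  then show ?thesis
    using z(2) by simp
qed

lemma OLEB_unique:
  assumes "OLEB \<Omega> \<alpha>1 \<alpha>2 a b L" "OLEB \<Omega> \<alpha>1 \<alpha>2 a b L'"
    and "x \<in> \<Omega>" "y \<in> \<Omega>" "x \<noteq> y"
  shows "L = L'"
proof (intro ext antisym)
  have leb: "lower_error_bound \<Omega> \<alpha>1 \<alpha>2 a b L" "lower_error_bound \<Omega> \<alpha>1 \<alpha>2 a b L'"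
    using assms(1,2) by (simp_all only: OLEB_def)
  show "L n \<le> L' n" "L' n \<le> L n" for n
    using OLEB_dominates_lower_error_bound assms leb by blast+
qed

section \<open>Criterion for the bound to vanish in the limit\<close>

lemma L_IM_tendsto_0_iff:
  assumes \<alpha>: "\<alpha>1 \<in> {0..1}" "\<alpha>2 \<in> {0..1}"
    and ab: "\<And>k. a k \<in> {0..1}" "\<And>k. b k \<in> {0..1}"
    and pos: "\<And>k. 0 < 1 - a k - \<alpha>1 * a k" "\<And>k. 0 < 1 - b k - \<alpha>2 * b k"
  shows "L_IM \<alpha>1 \<alpha>2 a b \<longlonglongrightarrow> 0
    \<longleftrightarrow> filterlim (\<lambda>n. \<Sum>k=0..n. a k + b k) at_top sequentially"
proof -
  define q where "q k = 1 - a k - \<alpha>1 * a k" for k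
  define r where "r k = 1 - b k - \<alpha>2 * b k" for k
  define t where "t k = 1 - q k * r k" for k
  \<comment> \<open>Here \<open>1 - q k = (1 + \<alpha>1) * a k\<close> lies between
    \<open>a k\<close> and \<open>2 * a k\<close> because \<open>0 \<le> \<alpha>1 \<le> 1\<close>;
    likewise for \<open>r\<close> below.\<close>
  have q: "0 < q k" "q k \<le> 1 - a k" "1 - q k \<le> 2 * a k" for k
    using pos(1)[of k] \<alpha>(1) ab(1)[of k] mult_right_mono[of \<alpha>1 1 "a k"] by (auto simp: q_def)
  have r: "0 < r k" "r k \<le> 1 - b k" "1 - r k \<le> 2 * b k" for k
    using pos(2)[of k] \<alpha>(2) ab(2)[of k] mult_right_mono[of \<alpha>2 1 "b k"] by (auto simp: r_def)
  have q1: "q k \<le> 1" and r1: "r k \<le> 1" for k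
    using q(2)[of k] r(2)[of k] ab[of k] by auto
  \<comment> \<open>The defect of the \<open>k\<close>-th factor dominates both \<open>a k\<close>
    and \<open>b k\<close> and is at most twice their sum, so comparison works in both
    directions.\<close>
  have t: "a k \<le> t k" "b k \<le> t k" "t k < 1" "t k \<le> 2 * (a k + b k)" for k
  proof -
    have "q k * r k \<le> q k"
      using mult_left_le[of "r k" "q k"] q(1)[of k] r1[of k] by simp
    then show "a k \<le> t k"
      using q(2)[of k] by (simp add: t_def)
    have "q k * r k \<le> r k"
      using mult_left_le[of "q k" "r k"] r(1)[of k] q1[of k] by (simp add: mult.commute)
    then show "b k \<le> t k"
      using r(2)[of k] by (simp add: t_def)
    show "t k < 1"
      using q(1)[of k] r(1)[of k] by (simp add: t_def)
    \<comment> \<open>Expanded, this says \<open>1 - q k * r k \<le> (1 - q k) + (1 - r k)\<close>: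
      defects are subadditive under products.\<close>
    have "0 \<le> (1 - q k) * (1 - r k)"
      using q1[of k] r1[of k] by simp
    then show "t k \<le> 2 * (a k + b k)"
      using q(3)[of k] r(3)[of k] by (simp add: t_def algebra_simps)
  qed
  have a0: "0 \<le> a k" and b0: "0 \<le> b k" for k
    using ab[of k] by auto
  have "summable t \<longleftrightarrow> summable (\<lambda>k. a k + b k)"
  proof
    assume "summable t"
    then show "summable (\<lambda>k. a k + b k)"
      using t(1,2) a0 b0
      by (intro summable_add) (auto intro: summable_comparison_test')
  next
    assume "summable (\<lambda>k. a k + b k)"
    then have "summable (\<lambda>k. 2 * (a k + b k))"
      by (rule summable_mult)
    then show "summable t"
    proof (rule summable_comparison_test')
      show "norm (t k) \<le> 2 * (a k + b k)" for k
        using t(1,4)[of k] a0[of k] by simp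
    qed
  qed
  moreover have "L_IM \<alpha>1 \<alpha>2 a b = (\<lambda>n. \<Prod>k\<le>n. 1 - t k)"
    by (simp add: fun_eq_iff L_IM_def t_def q_def r_def atLeast0AtMost)
  moreover have "(\<lambda>n. \<Prod>k\<le>n. 1 - t k) \<longlonglongrightarrow> 0 \<longleftrightarrow> \<not> summable t"
    by (rule prod_one_minus_tendsto_0_iff) (use a0 t(1,3) order_trans in blast)+
  moreover have "filterlim (\<lambda>n. \<Sum>k\<le>n. a k + b k) at_top sequentially
      \<longleftrightarrow> \<not> summable (\<lambda>k. a k + b k)"
    by (rule filterlim_sum_at_top_iff_not_summable) (simp add: a0 b0)
  ultimately show ?thesis
    by (simp add: atLeast0AtMost)
qed

text \<open>Attainment is stated under a reflection centre because it can fail for a merely convex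
  set, as \<open>not_OLEB_half_line\<close> shows. Uniqueness asks for two distinct points: on a
  singleton all errors are zero and any non-negative sequence is optimal.\<close>

theorem theorem3p5:
  fixes \<Omega> :: "'a::banach set" and \<alpha>1 \<alpha>2 :: real and a b :: "nat \<Rightarrow> real"
  assumes "\<alpha>1 \<in> {0..1}" and "\<alpha>2 \<in> {0..1}"
    and "0 < \<alpha>1 + \<alpha>2" and "\<alpha>1 + \<alpha>2 < 2"
    and "convex \<Omega>" and "\<Omega> \<noteq> {}"
    and "\<And>k. a k \<in> {0..1}" and "\<And>k. b k \<in> {0..1}"
    and "\<And>k. 1 - a k - \<alpha>1 * a k > 0" and "\<And>k. 1 - b k - \<alpha>2 * b k > 0"
  shows "lower_error_bound \<Omega> \<alpha>1 \<alpha>2 a b (L_IM \<alpha>1 \<alpha>2 a b)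
    \<and> (has_reflection_centre \<Omega> \<alpha>1 \<alpha>2 \<longrightarrow>
         OLEB \<Omega> \<alpha>1 \<alpha>2 a b (L_IM \<alpha>1 \<alpha>2 a b)
         \<and> ((\<exists>x\<in>\<Omega>. \<exists>y\<in>\<Omega>. x \<noteq> y) \<longrightarrow>
              (\<forall>L. OLEB \<Omega> \<alpha>1 \<alpha>2 a b L \<longrightarrow> L = L_IM \<alpha>1 \<alpha>2 a b)))
    \<and> (L_IM \<alpha>1 \<alpha>2 a b \<longlonglongrightarrow> 0
         \<longleftrightarrow> filterlim (\<lambda>n. \<Sum>k=0..n. a k + b k) at_top sequentially)"
proof (intro conjI impI allI)
  show leb: "lower_error_bound \<Omega> \<alpha>1 \<alpha>2 a b (L_IM \<alpha>1 \<alpha>2 a b)"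
    by (rule lower_error_bound_L_IM) (fact assms)+
  show oleb: "OLEB \<Omega> \<alpha>1 \<alpha>2 a b (L_IM \<alpha>1 \<alpha>2 a b)" if "has_reflection_centre \<Omega> \<alpha>1 \<alpha>2"
    using OLEB_L_IM[OF leb _ _ that] assms(1,2) by simp
  show "L = L_IM \<alpha>1 \<alpha>2 a b"
    if "has_reflection_centre \<Omega> \<alpha>1 \<alpha>2" "\<exists>x\<in>\<Omega>. \<exists>y\<in>\<Omega>. x \<noteq> y" "OLEB \<Omega> \<alpha>1 \<alpha>2 a b L" for L
    using OLEB_unique[OF that(3) oleb[OF that(1)]] that(2) by blast
  show "L_IM \<alpha>1 \<alpha>2 a b \<longlonglongrightarrow> 0
      \<longleftrightarrow> filterlim (\<lambda>n. \<Sum>k=0..n. a k + b k) at_top sequentially"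
    by (rule L_IM_tendsto_0_iff) (fact assms)+
qed

end
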